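(* It holds that $\int_0^1 \mathbb{T}(p)\,dp=\frac12$.
   Context: There are $n\ge 1$ boxes with independent nonnegative rewards $v_1,\dots,v_n$ whose distributions have no point masses. $Z=\max_{i\in[n]}v_i$ (the prophet), normalized so that $\mathbb{E}[Z]=1$. The quantile function of $Z$ is $Q(p)=\sup\{x\mid \Pr[Z\le x]=p\}$ for $p\in[0,1]$ (values in $\mathbb{R}_{\ge0}\cup\{\infty\}$). Define $\mathbb{T}:[0,1]\to\mathbb{R}_{\ge0}$ by $\mathbb{T}(p)=p\int_p^1 \frac{Q(q)}{q^2}\,dq$ for $p\in(0,1]$, with $\mathbb{T}(0)=\lim_{p\to0^+}\mathbb{T}(p)$. *)

theory Defs
  imports "HOL-Probability.Probability"
begin

definition prophet :: "nat \<Rightarrow> (nat \<Rightarrow> 'a \<Rightarrow> real) \<Rightarrow> 'a \<Rightarrow> real" where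
  "prophet n v \<omega> = Max ((\<lambda>i. v i \<omega>) ` {1..n})"

text \<open>
  The supremum ranges over all \<open>x\<close> in \<open>[0, \<infinity>]\<close>. Thus the quantile at \<open>1\<close> is \<open>\<infinity>\<close>, and never
  the supremum of an empty set of reals when \<open>Z\<close> is unbounded.
\<close>

definition quantile :: "'a measure \<Rightarrow> ('a \<Rightarrow> real) \<Rightarrow> real \<Rightarrow> ennreal" where
  "quantile M Z p = Sup {x. measure M {\<omega> \<in> space M. ennreal (Z \<omega>) \<le> x} = p}"

text \<open>
  The values are taken in \<open>[0, \<infinity>]\<close>, so that both integrals are total and no convention for
  divergent integrals enters the definition.
\<close>

definition TT_pos :: "(real \<Rightarrow> ennreal) \<Rightarrow> real \<Rightarrow> ennreal" where
  "TT_pos Q p = ennreal p * (\<integral>\<^sup>+q\<in>{p..1}. (Q q / ennreal (q\<^sup>2)) \<partial>lborel)"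

definition TT :: "(real \<Rightarrow> ennreal) \<Rightarrow> real \<Rightarrow> ennreal" where
  "TT Q p = (if p = 0 then Lim (at_right 0) (TT_pos Q) else TT_pos Q p)"

end

theory Submission
  imports Defs
begin

text \<open>
  Exchanging the order of integration turns the integral of \<open>TT Q\<close> into the integral of
  \<open>Q(q)/q\<^sup>2 \<cdot> q\<^sup>2/2\<close>, i.e. half the integral of \<open>Q\<close> over the unit interval. By the layer-cake
  formula that integral is the expectation of \<open>Z\<close>, because \<open>{p. Q p > x}\<close> is, up to one point, the
  interval from \<open>P(Z \<le> x)\<close> to \<open>1\<close>. The rewards enter only through the fact that \<open>Z\<close> has no
  atoms.
\<close>

section \<open>Layer-cake formula for functions with values in \<open>ennreal\<close>\<close>

text \<open>\<open>f x\<close> is the length of the set of \<open>t \<ge> 0\<close> below it, and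
  Tonelli exchanges the two integrals. Infinite values are allowed and \<open>M\<close> is only
  sigma-finite, so that the formula covers both a quantile function on \<open>lborel\<close> and a
  random variable on a probability space.\<close>

lemma nn_integral_layer_cake:
  fixes f :: "'a \<Rightarrow> ennreal"
  assumes "sigma_finite_measure M" and [measurable]: "f \<in> borel_measurable M"
  shows "(\<integral>\<^sup>+x. f x \<partial>M) = (\<integral>\<^sup>+t\<in>{0..}. emeasure M {x \<in> space M. ennreal t < f x} \<partial>lborel)"
proof -
  interpret M: sigma_finite_measure M by fact
  interpret pair_sigma_finite M lborel by standard
  have length: "(\<integral>\<^sup>+t. indicator {t. 0 \<le> t \<and> ennreal t < y} t \<partial>lborel) = y" for y
  proof (cases y)
    case (real r)
    then have "{t. 0 \<le> t \<and> ennreal t < y} = {0..<r}"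
      by (auto simp: ennreal_less_iff)
    with real show ?thesis by simp
  next
    case top
    then have "{t. 0 \<le> t \<and> ennreal t < y} = {0..}" by auto
    moreover have "emeasure lborel {0::real..} = \<infinity>"
    proof -
      have "ennreal (real n) \<le> emeasure lborel {0::real..}" for n
        using emeasure_mono[of "{0..real n}" "{0..}" lborel] by auto
      then have "of_nat n \<le> emeasure lborel {0::real..}" for n
        by (simp add: ennreal_of_nat_eq_real_of_nat)
      then show ?thesis
        using ennreal_SUP_of_nat_eq_top
        by (metis SUP_least infinity_ennreal_def top_unique)
    qed
    ultimately show ?thesis using top by simp
  qed
  have "(\<integral>\<^sup>+x. f x \<partial>M) =
      (\<integral>\<^sup>+x. \<integral>\<^sup>+t. indicator {t. 0 \<le> t \<and> ennreal t < f x} t \<partial>lborel \<partial>M)"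
    by (simp add: length)
  also have "\<dots> = (\<integral>\<^sup>+t. \<integral>\<^sup>+x. indicator {t. 0 \<le> t \<and> ennreal t < f x} t \<partial>M \<partial>lborel)"
    by (rule Fubini'[symmetric]) (simp add: indicator_def)
  also have "\<dots> = (\<integral>\<^sup>+t\<in>{0..}. emeasure M {x \<in> space M. ennreal t < f x} \<partial>lborel)"
  proof (rule nn_integral_cong)
    fix t :: real
    have "(\<integral>\<^sup>+x. indicator {t. 0 \<le> t \<and> ennreal t < f x} t \<partial>M) =
        (\<integral>\<^sup>+x. indicator {0..} t * indicator {x \<in> space M. ennreal t < f x} x \<partial>M)"
      by (rule nn_integral_cong) (auto simp: indicator_def)
    then show "(\<integral>\<^sup>+x. indicator {t. 0 \<le> t \<and> ennreal t < f x} t \<partial>M) =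
        emeasure M {x \<in> space M. ennreal t < f x} * indicator {0..} t"
      by (simp add: nn_integral_cmult mult.commute)
  qed
  finally show ?thesis .
qed

section \<open>Integral of \<open>TT_pos\<close> by exchanging the order of integration\<close>

lemma nn_integral_ident_Icc:
  assumes "0 \<le> (q::real)"
  shows "(\<integral>\<^sup>+p\<in>{0..q}. ennreal p \<partial>lborel) = ennreal (q\<^sup>2 / 2)"
proof -
  have "(\<integral>\<^sup>+p\<in>{0..q}. ennreal p \<partial>lborel) = ennreal (q\<^sup>2 / 2 - 0\<^sup>2 / 2)"
    by (rule nn_integral_FTC_Icc[where F = "\<lambda>p. p\<^sup>2 / 2"])
       (use assms in \<open>auto intro!: derivative_eq_intros\<close>)
  then show ?thesis by simp
qed

text \<open>Tonelli on the triangle \<open>0 \<le> p \<le> q \<le> 1\<close>: for fixed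
  \<open>q\<close> the factor \<open>p\<close> integrates to \<open>q\<^sup>2 / 2\<close>, which
  cancels the weight \<open>1 / q\<^sup>2\<close> up to one half.\<close>

lemma nn_integral_TT_pos:
  assumes [measurable]: "g \<in> borel_measurable borel"
  shows "(\<integral>\<^sup>+p\<in>{0..1}. TT_pos g p \<partial>lborel) = (\<integral>\<^sup>+q\<in>{0<..<1}. g q \<partial>lborel) / 2"
proof -
  have "(\<integral>\<^sup>+p\<in>{0..1}. TT_pos g p \<partial>lborel) =
      (\<integral>\<^sup>+p. \<integral>\<^sup>+q. ennreal p * (g q / ennreal (q\<^sup>2)) *
        (if 0 \<le> p \<and> p \<le> q \<and> q \<le> 1 then 1 else 0) \<partial>lborel \<partial>lborel)"
  proof (rule nn_integral_cong)
    fix p :: real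
    have "(\<integral>\<^sup>+q. ennreal p * (g q / ennreal (q\<^sup>2)) *
          (if 0 \<le> p \<and> p \<le> q \<and> q \<le> 1 then 1 else 0) \<partial>lborel) =
        (\<integral>\<^sup>+q. ennreal p * indicator {0..1} p *
          (g q / ennreal (q\<^sup>2) * indicator {p..1} q) \<partial>lborel)"
      by (rule nn_integral_cong) (simp add: indicator_def)
    also have "\<dots> = ennreal p * indicator {0..1} p *
        (\<integral>\<^sup>+q\<in>{p..1}. (g q / ennreal (q\<^sup>2)) \<partial>lborel)"
      by (rule nn_integral_cmult) measurable
    finally show "TT_pos g p * indicator {0..1} p =
        (\<integral>\<^sup>+q. ennreal p * (g q / ennreal (q\<^sup>2)) *
          (if 0 \<le> p \<and> p \<le> q \<and> q \<le> 1 then 1 else 0) \<partial>lborel)"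
      by (simp add: TT_pos_def mult_ac)
  qed
  also have "\<dots> = (\<integral>\<^sup>+q. \<integral>\<^sup>+p. ennreal p * (g q / ennreal (q\<^sup>2)) *
        (if 0 \<le> p \<and> p \<le> q \<and> q \<le> 1 then 1 else 0) \<partial>lborel \<partial>lborel)"
    by (rule lborel_pair.Fubini'[symmetric]) measurable
  also have "\<dots> = (\<integral>\<^sup>+q. g q * indicator {0<..<1} q / 2 \<partial>lborel)"
  proof (rule nn_integral_cong_AE)
    \<comment> \<open>At \<open>q = 1\<close> the right-hand side is cut off while the left-hand
      side need not vanish, and at \<open>q = 0\<close> the weight cannot be cancelled. Both points
      are null.\<close>
    have "AE q in lborel. q \<noteq> (0::real)" "AE q in lborel. q \<noteq> (1::real)"
      by (auto intro: AE_lborel_singleton)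
    then show "AE q in lborel. (\<integral>\<^sup>+p. ennreal p * (g q / ennreal (q\<^sup>2)) *
        (if 0 \<le> p \<and> p \<le> q \<and> q \<le> 1 then 1 else 0) \<partial>lborel) =
        g q * indicator {0<..<1} q / 2"
    proof eventually_elim
      case (elim q)
      show ?case
      proof (cases "0 < q \<and> q < 1")
        case True
        have "(\<integral>\<^sup>+p. ennreal p * (g q / ennreal (q\<^sup>2)) *
            (if 0 \<le> p \<and> p \<le> q \<and> q \<le> 1 then 1 else 0) \<partial>lborel) =
            (\<integral>\<^sup>+p. (g q / ennreal (q\<^sup>2)) * (ennreal p * indicator {0..q} p) \<partial>lborel)"
          using True by (intro nn_integral_cong) (auto simp: indicator_def mult.commute)
        also have "\<dots> = (g q / ennreal (q\<^sup>2)) * ennreal (q\<^sup>2 / 2)"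
          using True by (subst nn_integral_cmult) (auto simp: nn_integral_ident_Icc)
        \<comment> \<open>Only the finite nonzero \<open>q\<^sup>2\<close> gets cancelled, so
          \<open>g q\<close> may be infinite.\<close>
        also have "\<dots> = g q * (ennreal (q\<^sup>2 / 2) / ennreal (q\<^sup>2))"
          by (simp add: divide_ennreal_def mult_ac)
        also have "ennreal (q\<^sup>2 / 2) / ennreal (q\<^sup>2) = ennreal (1 / 2)"
          using True by (subst divide_ennreal) auto
        also have "ennreal (1 / 2) = 1 / 2"
          by (metis divide_ennreal ennreal_1 ennreal_numeral zero_le_one zero_less_numeral)
        finally show ?thesis
          using True by (simp add: ennreal_times_divide)
      next
        case False
        then have "\<not> (0 \<le> p \<and> p \<le> q \<and> q \<le> 1)" for p
          using elim by auto
        then show ?thesis using False by (simp only: if_False) simp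
      qed
    qed
  qed
  also have "\<dots> = (\<integral>\<^sup>+q\<in>{0<..<1}. g q \<partial>lborel) / 2"
    by (rule nn_integral_divide) simp
  finally show ?thesis .
qed

text \<open>For \<open>p > 0\<close> the integral over \<open>{p..1}\<close> sees values outside the
  open unit interval only at the null point \<open>1\<close>. This allows a measurable cut-off to
  replace the quantile.\<close>

lemma TT_eq_TT_pos:
  assumes "0 < p" "\<And>q. q \<in> {0<..<1} \<Longrightarrow> Q q = g q"
  shows "TT Q p = TT_pos g p"
proof -
  have "AE q in lborel. q \<noteq> (1::real)"
    by (rule AE_lborel_singleton)
  then have "(\<integral>\<^sup>+q\<in>{p..1}. (Q q / ennreal (q\<^sup>2)) \<partial>lborel) =
      (\<integral>\<^sup>+q\<in>{p..1}. (g q / ennreal (q\<^sup>2)) \<partial>lborel)"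
    using assms by (intro nn_integral_cong_AE) (auto elim!: eventually_mono simp: indicator_def)
  then show ?thesis
    using assms(1) by (simp add: TT_def TT_pos_def)
qed

section \<open>Quantile function of an atomless random variable\<close>

locale atomless_rv = prob_space M for M :: "'a measure" +
  fixes Z :: "'a \<Rightarrow> real"
  assumes measurable_Z [measurable]: "Z \<in> borel_measurable M"
    and atomless: "prob {\<omega> \<in> space M. Z \<omega> = x} = 0"
begin

abbreviation F :: "real \<Rightarrow> real" where
  "F \<equiv> cdf (distr M borel Z)"

lemma F_eq: "F x = prob {\<omega> \<in> space M. Z \<omega> \<le> x}"
  by (auto simp: cdf_def measure_distr intro!: arg_cong[where f = prob])

lemma prob_ennreal_Z_le: "0 \<le> x \<Longrightarrow> prob {\<omega> \<in> space M. ennreal (Z \<omega>) \<le> ennreal x} = F x"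
  by (simp add: F_eq)

lemma F_nonneg: "0 \<le> F x"
  by (simp add: F_eq)

lemma real_distribution_Z: "real_distribution (distr M borel Z)"
  by (rule real_distribution_distr) measurable

lemma isCont_F: "isCont F x"
proof -
  interpret D: real_distribution "distr M borel Z" by (rule real_distribution_Z)
  have "measure (distr M borel Z) {x} = prob {\<omega> \<in> space M. Z \<omega> = x}"
    by (auto simp: measure_distr intro!: arg_cong[where f = prob])
  then show ?thesis
    by (simp add: D.isCont_cdf atomless)
qed

text \<open>\<open>F\<close> is continuous and tends to 1, so it passes every level
  \<open>p < 1\<close>. The point found differs from \<open>x\<close> because
  \<open>F x \<noteq> p\<close>.\<close>

lemma F_attains_greater:
  assumes "F x < p" "p < 1"
  obtains y where "x < y" "F y = p"
proof -
  interpret D: real_distribution "distr M borel Z" by (rule real_distribution_Z)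
  have "eventually (\<lambda>y. p < F y \<and> x \<le> y) at_top"
    using order_tendstoD(1)[OF D.cdf_lim_at_top_prob assms(2)] eventually_ge_at_top
    by (rule eventually_conj)
  then obtain b where b: "p < F b" "x \<le> b"
    using eventually_happens[of _ "at_top :: real filter"] by auto
  obtain y where "x \<le> y" "F y = p"
    using IVT[of F x p b] assms(1) b isCont_F by auto
  with assms(1) show ?thesis
    by (intro that[of y]) (cases "x = y", auto)
qed

text \<open>The level \<open>p\<close> is attained strictly to the right of \<open>x\<close>, and
  the quantile bounds every point where it is attained.\<close>

lemma less_quantile:
  assumes "0 \<le> x" "F x < p" "p < 1"
  shows "ennreal x < quantile M Z p"
proof -
  obtain y where y: "x < y" "F y = p"
    using F_attains_greater assms(2,3) by blast
  have "ennreal x < ennreal y"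
    using assms(1) y(1) by (simp add: ennreal_lessI)
  also have "ennreal y \<le> quantile M Z p"
    unfolding quantile_def using assms(1) y by (intro Sup_upper) (simp add: prob_ennreal_Z_le del: ennreal_le_iff)
  finally show ?thesis .
qed

text \<open>Some point above \<open>x\<close> attains the level \<open>p\<close>, and distribution
  functions are monotone. The bound is not strict, since \<open>F\<close> may be constant to the
  right of \<open>x\<close>.\<close>

lemma F_le_if_less_quantile:
  assumes "0 \<le> x" "ennreal x < quantile M Z p"
  shows "F x \<le> p"
proof -
  obtain y where y: "ennreal x < y" "prob {\<omega> \<in> space M. ennreal (Z \<omega>) \<le> y} = p"
    using assms(2) unfolding quantile_def less_Sup_iff by auto
  have "prob {\<omega> \<in> space M. ennreal (Z \<omega>) \<le> ennreal x} \<le>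
      prob {\<omega> \<in> space M. ennreal (Z \<omega>) \<le> y}"
    using y(1) by (intro finite_measure_mono) auto
  with y(2) assms(1) show ?thesis by (simp add: prob_ennreal_Z_le del: ennreal_le_iff)
qed

text \<open>
  The quantile is infinite at \<open>1\<close>; cutting it off changes no integral over the unit interval.
\<close>

definition Q :: "real \<Rightarrow> ennreal" where
  "Q p = quantile M Z p * indicator {0<..<1} p"

text \<open>The two preceding bounds combined. The level \<open>p = F x\<close> is left out because
  there the answer depends on whether \<open>F\<close> is constant just to the right of
  \<open>x\<close>.\<close>

lemma less_Q_iff:
  assumes "0 \<le> x" "p \<noteq> F x"
  shows "ennreal x < Q p \<longleftrightarrow> F x < p \<and> p < 1"
  using assms F_nonneg[of x] less_quantile[of x p] F_le_if_less_quantile[of x p]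
  by (auto simp: Q_def indicator_def)

lemma borel_measurable_Q [measurable]: "Q \<in> borel_measurable borel"
proof (rule borel_measurableI_greater)
  fix y :: ennreal
  show "{p \<in> space borel. y < Q p} \<in> sets borel"
  proof (cases y)
    case (real x)
    \<comment> \<open>Membership is undecided only at \<open>F x\<close>, and any subset of a
      singleton is Borel.\<close>
    have "{p. y < Q p} = {p. y < Q p} \<inter> {F x} \<union> ({F x<..<1} - {F x})"
    proof (rule set_eqI)
      fix p
      show "p \<in> {p. y < Q p} \<longleftrightarrow> p \<in> {p. y < Q p} \<inter> {F x} \<union> ({F x<..<1} - {F x})"
        using less_Q_iff[of x p] real by (cases "p = F x") auto
    qed
    also have "\<dots> \<in> sets borel"
      by (cases "y < Q (F x)") auto
    finally show ?thesis by simp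
  qed simp
qed

text \<open>At each \<open>x \<ge> 0\<close>, \<open>Q\<close> under \<open>lborel\<close> and
  \<open>Z\<close> under \<open>M\<close> have the same tail \<open>1 - F x\<close>, so their
  layer-cake integrals agree.\<close>

lemma nn_integral_Q: "(\<integral>\<^sup>+p. Q p \<partial>lborel) = (\<integral>\<^sup>+\<omega>. ennreal (Z \<omega>) \<partial>M)"
proof -
  have tail: "emeasure lborel {p. ennreal x < Q p} =
      emeasure M {\<omega> \<in> space M. ennreal x < ennreal (Z \<omega>)}" if "0 \<le> x" for x
  proof -
    have "AE p in lborel. p \<noteq> F x"
      by (rule AE_lborel_singleton)
    then have "emeasure lborel {p. ennreal x < Q p} = emeasure lborel {F x<..<1}"
      using less_Q_iff[OF that] by (intro emeasure_eq_AE) (auto elim!: eventually_mono)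
    also have "\<dots> = ennreal (1 - F x)"
      using real_distribution.cdf_bounded_prob[OF real_distribution_Z] by simp
    also have "1 - F x = prob (space M - {\<omega> \<in> space M. Z \<omega> \<le> x})"
      by (subst prob_compl) (auto simp: F_eq)
    also have "space M - {\<omega> \<in> space M. Z \<omega> \<le> x} =
        {\<omega> \<in> space M. ennreal x < ennreal (Z \<omega>)}"
      using that by (auto simp: ennreal_less_iff)
    finally show ?thesis by (simp add: emeasure_eq_measure)
  qed
  have "(\<integral>\<^sup>+p. Q p \<partial>lborel) = (\<integral>\<^sup>+x\<in>{0..}. emeasure lborel {p. ennreal x < Q p} \<partial>lborel)"
    by (subst nn_integral_layer_cake) (auto simp: lborel.sigma_finite_measure_axioms)
  also have "\<dots> = (\<integral>\<^sup>+x\<in>{0..}. emeasure M {\<omega> \<in> space M. ennreal x < ennreal (Z \<omega>)} \<partial>lborel)"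
    by (rule nn_integral_cong) (auto simp: indicator_def tail)
  also have "\<dots> = (\<integral>\<^sup>+\<omega>. ennreal (Z \<omega>) \<partial>M)"
    by (rule nn_integral_layer_cake[symmetric]) (auto simp: sigma_finite_measure_axioms)
  finally show ?thesis .
qed

lemma nn_integral_TT_quantile:
  "(\<integral>\<^sup>+p\<in>{0..1}. TT (quantile M Z) p \<partial>lborel) = (\<integral>\<^sup>+\<omega>. ennreal (Z \<omega>) \<partial>M) / 2"
proof -
  \<comment> \<open>Away from the null point \<open>0\<close>, \<open>TT\<close> is given by its
    integral formula.\<close>
  have "AE p in lborel. p \<noteq> (0::real)"
    by (rule AE_lborel_singleton)
  then have "(\<integral>\<^sup>+p\<in>{0..1}. TT (quantile M Z) p \<partial>lborel) = (\<integral>\<^sup>+p\<in>{0..1}. TT_pos Q p \<partial>lborel)"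
    by (intro nn_integral_cong_AE)
       (auto elim!: eventually_mono simp: indicator_def Q_def intro!: TT_eq_TT_pos)
  also have "\<dots> = (\<integral>\<^sup>+q\<in>{0<..<1}. Q q \<partial>lborel) / 2"
    by (rule nn_integral_TT_pos) measurable
  also have "(\<integral>\<^sup>+q\<in>{0<..<1}. Q q \<partial>lborel) = (\<integral>\<^sup>+q. Q q \<partial>lborel)"
    by (rule nn_integral_cong) (auto simp: Q_def indicator_def)
  finally show ?thesis by (simp add: nn_integral_Q)
qed

end

section \<open>Application to the prophet\<close>

text \<open>The maximum of a nonempty finite family is attained, so \<open>Z = x\<close> forces
  \<open>v i = x\<close> for some \<open>i\<close>. A union bound over these null events
  concludes.\<close>

lemma atomless_rv_prophet:
  assumes "prob_space M" "n \<ge> 1"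
    and [measurable]: "\<And>i. i \<in> {1..n} \<Longrightarrow> v i \<in> borel_measurable M"
    and "\<And>i x. i \<in> {1..n} \<Longrightarrow> measure M {\<omega> \<in> space M. v i \<omega> = x} = 0"
  shows "atomless_rv M (prophet n v)"
proof -
  interpret prob_space M by fact
  have [measurable]: "prophet n v \<in> borel_measurable M"
    unfolding prophet_def[abs_def] by (rule borel_measurable_Max) auto
  show ?thesis
  proof
    fix x
    have "prophet n v \<omega> \<in> (\<lambda>i. v i \<omega>) ` {1..n}" for \<omega>
      unfolding prophet_def using assms(2) by (intro Max_in) auto
    then have "\<exists>i\<in>{1..n}. v i \<omega> = prophet n v \<omega>" for \<omega>
      by (metis imageE)
    then have "{\<omega> \<in> space M. prophet n v \<omega> = x} \<subseteq> (\<Union>i\<in>{1..n}. {\<omega> \<in> space M. v i \<omega> = x})"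
      by blast
    then have "prob {\<omega> \<in> space M. prophet n v \<omega> = x} \<le>
        prob (\<Union>i\<in>{1..n}. {\<omega> \<in> space M. v i \<omega> = x})"
      by (intro finite_measure_mono) auto
    also have "\<dots> \<le> (\<Sum>i\<in>{1..n}. prob {\<omega> \<in> space M. v i \<omega> = x})"
      by (intro finite_measure_subadditive_finite) auto
    also have "\<dots> = 0"
      using assms(4) by simp
    finally show "prob {\<omega> \<in> space M. prophet n v \<omega> = x} = 0"
      by (simp add: antisym)
  qed measurable
qed

lemma AE_prophet_nonneg:
  assumes "n \<ge> 1" "AE \<omega> in M. 0 \<le> v 1 \<omega>"
  shows "AE \<omega> in M. 0 \<le> prophet n v \<omega>"
proof -
  have "v 1 \<omega> \<le> prophet n v \<omega>" for \<omega>
    unfolding prophet_def using assms(1) by (intro Max_ge) auto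
  with assms(2) show ?thesis
    by (auto elim!: eventually_mono intro: order_trans)
qed

theorem claim3:
  fixes M :: "'a measure" and n :: nat and v :: "nat \<Rightarrow> 'a \<Rightarrow> real"
  assumes "prob_space M"
    and "n \<ge> 1"
    and "prob_space.indep_vars M (\<lambda>_. borel) v {1..n}"
    and "\<And>i. i \<in> {1..n} \<Longrightarrow> AE \<omega> in M. 0 \<le> v i \<omega>"
    and "\<And>i x. i \<in> {1..n} \<Longrightarrow> measure M {\<omega> \<in> space M. v i \<omega> = x} = 0"
    and "integrable M (prophet n v)"
    and "(\<integral>\<omega>. prophet n v \<omega> \<partial>M) = 1"
  shows "(\<integral>\<^sup>+p\<in>{0..1}. TT (quantile M (prophet n v)) p \<partial>lborel) = ennreal (1 / 2)"
proof -
  interpret prob_space M by fact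
  have "v i \<in> borel_measurable M" if "i \<in> {1..n}" for i
    using assms(3) that unfolding indep_vars_def by auto
  then interpret atomless_rv M "prophet n v"
    using assms by (intro atomless_rv_prophet)
  have nonneg: "AE \<omega> in M. 0 \<le> prophet n v \<omega>"
    using assms(2,4) by (intro AE_prophet_nonneg) auto
  \<comment> \<open>Nonnegativity turns the normalisation of the Bochner integral into one of the
    nonnegative integral.\<close>
  have "(\<integral>\<^sup>+\<omega>. ennreal (prophet n v \<omega>) \<partial>M) = ennreal 1"
    using nn_integral_eq_integral[OF assms(6) nonneg] assms(7) by simp
  then have "(\<integral>\<^sup>+p\<in>{0..1}. TT (quantile M (prophet n v)) p \<partial>lborel) = ennreal 1 / ennreal 2"
    by (simp add: nn_integral_TT_quantile)
  also have "\<dots> = ennreal (1 / 2)"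
    by (rule divide_ennreal) auto
  finally show ?thesis .
qed

end
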